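(* Let $H$ be a Hilbert space, let $(\Omega,\mu)$ be a measure space with positive measure $\mu$, let $F,G:\Omega\to H$ be mappings, and let $T$ be an invertible bounded linear operator on $H$. Then $(F,G)$ is a continuous biframe for $H$ with respect to $(\Omega,\mu)$ if and only if $(TF,TG)$ is a continuous biframe for $H$ with respect to $(\Omega,\mu)$.
   Context: Inner products are linear in the first variable. $TF$ denotes the mapping $w\mapsto T(F(w))$, and similarly $TG$. A pair $(F,G)$ of mappings $F,G:\Omega\to H$ is called a continuous biframe for $H$ with respect to $(\Omega,\mu)$ if (i) $F$ and $G$ are weakly measurable, i.e. for every $f\in H$ the functions $w\mapsto\langle f,F(w)\rangle$ and $w\mapsto\langle f,G(w)\rangle$ are measurable on $\Omega$; and (ii) there exist constants $0<A\le B<\infty$ such that for all $f\in H$ $$A\|f\|^2\le\int_\Omega\langle f,F(w)\rangle\langle G(w),f\rangle\,d\mu\le B\|f\|^2,$$ where it is implicit that the integrand is integrable and the integral is a real number. *)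

theory Defs
  imports "HOL-Analysis.Analysis"
begin

text \<open>
  Complex inner product spaces, with the inner product linear in its first argument.
  Building on \<^class>\<open>real_normed_vector\<close> ties the norm, the topology and the
  underlying real vector space structure to the inner product; the normed space axioms
  themselves follow from the axioms below.
\<close>

class complex_inner = real_normed_vector +
  fixes scaleC :: "complex \<Rightarrow> 'a \<Rightarrow> 'a"  (infixr "*\<^sub>C" 75)
    and cinner :: "'a \<Rightarrow> 'a \<Rightarrow> complex"
  assumes scaleC_add_right: "a *\<^sub>C (x + y) = a *\<^sub>C x + a *\<^sub>C y"
    and scaleC_add_left: "(a + b) *\<^sub>C x = a *\<^sub>C x + b *\<^sub>C x"
    and scaleC_scaleC: "a *\<^sub>C (b *\<^sub>C x) = (a * b) *\<^sub>C x"
    and scaleC_of_real: "complex_of_real r *\<^sub>C x = r *\<^sub>R x"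
    and cinner_commute: "cinner x y = cnj (cinner y x)"
    and cinner_add_left: "cinner (x + y) z = cinner x z + cinner y z"
    and cinner_scaleC_left: "cinner (a *\<^sub>C x) y = a * cinner x y"
    and cinner_self: "cinner x x = complex_of_real ((norm x)\<^sup>2)"

class chilbert_space = complex_inner + complete_space

instantiation complex :: chilbert_space
begin

definition scaleC_complex :: "complex \<Rightarrow> complex \<Rightarrow> complex"
  where "scaleC_complex a x = a * x"

definition cinner_complex :: "complex \<Rightarrow> complex \<Rightarrow> complex"
  where "cinner_complex x y = x * cnj y"

instance
proof
  fix x :: complex
  show "cinner x x = complex_of_real ((norm x)\<^sup>2)"
    unfolding cinner_complex_def by (rule complex_norm_square [symmetric])
qed (simp_all add: scaleC_complex_def cinner_complex_def distrib_left distrib_right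
      mult.assoc scaleR_conv_of_real)

end

definition bounded_clinear :: "('a::complex_inner \<Rightarrow> 'b::complex_inner) \<Rightarrow> bool"
  where "bounded_clinear T \<longleftrightarrow>
    bounded_linear T \<and> (\<forall>c x. T (c *\<^sub>C x) = c *\<^sub>C T x)"

text \<open>Invertible as an element of the algebra of bounded linear operators.\<close>

definition invertible_bounded_clinear :: "('a::complex_inner \<Rightarrow> 'a) \<Rightarrow> bool"
  where "invertible_bounded_clinear T \<longleftrightarrow>
    bounded_clinear T \<and> (\<exists>S. bounded_clinear S \<and> S \<circ> T = id \<and> T \<circ> S = id)"

definition weakly_measurable :: "'w measure \<Rightarrow> ('w \<Rightarrow> 'a::complex_inner) \<Rightarrow> bool"
  where "weakly_measurable M F \<longleftrightarrow> (\<forall>f. (\<lambda>w. cinner f (F w)) \<in> borel_measurable M)"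

text \<open>
  The Bochner integral of a non-integrable function is 0 by convention, so integrability
  has to be required explicitly. The integral is complex-valued, so the two inequalities
  are read as: it is real, and its real part satisfies the bounds.
\<close>

definition continuous_biframe ::
    "'w measure \<Rightarrow> ('w \<Rightarrow> 'a::complex_inner) \<Rightarrow> ('w \<Rightarrow> 'a) \<Rightarrow> bool"
  where "continuous_biframe M F G \<longleftrightarrow>
    weakly_measurable M F \<and> weakly_measurable M G \<and>
    (\<exists>A B. 0 < A \<and> A \<le> B \<and>
      (\<forall>f. integrable M (\<lambda>w. cinner f (F w) * cinner (G w) f) \<and>
           (\<integral>w. cinner f (F w) * cinner (G w) f \<partial>M) \<in> \<real> \<and>
           A * (norm f)\<^sup>2 \<le> Re (\<integral>w. cinner f (F w) * cinner (G w) f \<partial>M) \<and>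
           Re (\<integral>w. cinner f (F w) * cinner (G w) f \<partial>M) \<le> B * (norm f)\<^sup>2))"

end

theory Submission
  imports Defs
begin

text \<open>
  If \<open>T\<close> has an adjoint \<open>T'\<close>, then the biframe integral of \<open>(TF, TG)\<close> at \<open>f\<close> is the biframe
  integral of \<open>(F, G)\<close> at \<open>T' f\<close>, because
  \<open>\<langle>f, T F(w)\<rangle> \<langle>T G(w), f\<rangle> = \<langle>T' f, F(w)\<rangle> \<langle>G(w), T' f\<rangle>\<close>.
  Measurability, integrability and reality carry over at once. The bounds carry over because
  \<open>\<parallel>T' f\<parallel>\<close> and \<open>\<parallel>f\<parallel>\<close> are comparable: \<open>T'\<close> is bounded since \<open>T\<close> is, and it is bounded below since
  \<open>T\<close> has a bounded right inverse. The converse implication is the same statement for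
  \<open>T\<^sup>-\<^sup>1\<close> and the pair \<open>(TF, TG)\<close>.

  The adjoint comes from the Riesz representation theorem, and this is where completeness enters.
  The representing vector of a bounded functional \<open>h\<close> is the minimizer of
  \<open>\<parallel>x\<parallel>\<^sup>2 - 2 h x\<close>: by the parallelogram law every minimizing sequence is Cauchy, and the vanishing
  first variation at the minimizer says that it represents \<open>h\<close>. It is enough to do this for
  real functionals and the real inner product \<open>Re \<langle>x, y\<rangle>\<close>, since complex linearity
  recovers imaginary parts from real parts.
\<close>

section \<open>Inner product identities\<close>

lemma cinner_add_right: "cinner x (y + z) = cinner x y + cinner (x::'a::complex_inner) z"
  by (metis cinner_add_left cinner_commute complex_cnj_add)

lemma cinner_scaleR_left: "cinner (r *\<^sub>R x) y = of_real r * cinner (x::'a::complex_inner) y"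
  by (metis cinner_scaleC_left scaleC_of_real)

lemma Re_cinner_commute: "Re (cinner x y) = Re (cinner (y::'a::complex_inner) x)"
  by (subst cinner_commute) simp

lemma Re_cinner_self: "Re (cinner x x) = (norm (x::'a::complex_inner))\<^sup>2"
  by (simp add: cinner_self)

lemma norm_add_scaleR_squared:
  fixes x y :: "'a::complex_inner"
  shows "(norm (x + t *\<^sub>R y))\<^sup>2 = (norm x)\<^sup>2 + 2 * t * Re (cinner y x) + t\<^sup>2 * (norm y)\<^sup>2"
proof -
  have "(norm (x + t *\<^sub>R y))\<^sup>2 = Re (cinner (x + t *\<^sub>R y) (x + t *\<^sub>R y))"
    by (simp add: Re_cinner_self)
  also have "\<dots> = Re (cinner x x) + t * Re (cinner y x) + Re (cinner x (t *\<^sub>R y))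
      + t * Re (cinner y (t *\<^sub>R y))"
    by (simp add: cinner_add_left cinner_add_right cinner_scaleR_left)
  also have "Re (cinner x (t *\<^sub>R y)) = t * Re (cinner y x)"
    by (subst Re_cinner_commute) (simp add: cinner_scaleR_left)
  also have "Re (cinner y (t *\<^sub>R y)) = t * (norm y)\<^sup>2"
    by (subst Re_cinner_commute) (simp add: cinner_scaleR_left Re_cinner_self)
  finally show ?thesis
    by (simp add: Re_cinner_self power2_eq_square)
qed

lemma parallelogram_law:
  fixes x y :: "'a::complex_inner"
  shows "(norm (x + y))\<^sup>2 + (norm (x - y))\<^sup>2 = 2 * (norm x)\<^sup>2 + 2 * (norm y)\<^sup>2"
  using norm_add_scaleR_squared[of x 1 y] norm_add_scaleR_squared[of x "-1" y] by simp

text \<open>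
  The norm axioms already contain the triangle inequality, so the Cauchy-Schwarz inequality
  follows from it by expanding the square \<open>\<parallel>x + y\<parallel>\<^sup>2\<close>.
\<close>

lemma Re_cinner_le_norm: "Re (cinner x y) \<le> norm x * norm (y::'a::complex_inner)"
proof -
  have "(norm (y + x))\<^sup>2 \<le> (norm y + norm x)\<^sup>2"
    by (simp add: norm_triangle_ineq)
  moreover have "(norm (y + x))\<^sup>2 = (norm y)\<^sup>2 + 2 * Re (cinner x y) + (norm x)\<^sup>2"
    using norm_add_scaleR_squared[of y 1 x] by simp
  ultimately show ?thesis
    by (simp add: power2_sum mult.commute[of "norm y"])
qed

lemma abs_Re_cinner_le_norm: "\<bar>Re (cinner x y)\<bar> \<le> norm x * norm (y::'a::complex_inner)"
  using Re_cinner_le_norm[of x y] Re_cinner_le_norm[of "-1 *\<^sub>R x" y]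
  by (simp add: cinner_scaleR_left[of "-1" x y, simplified])

lemma Im_cinner_conv_Re: "Im (cinner x y) = Re (cinner ((- \<i>) *\<^sub>C x) (y::'a::complex_inner))"
  by (simp add: cinner_scaleC_left)

section \<open>Riesz representation\<close>

text \<open>
  Write \<open>J x = \<parallel>x\<parallel>\<^sup>2 - 2 h x\<close>. The linear part of \<open>J\<close> cancels in
  \<open>2 J x + 2 J y - 4 J ((x + y) / 2)\<close>, so the parallelogram law identifies this difference with
  \<open>\<parallel>x - y\<parallel>\<^sup>2\<close>. Two points at which \<open>J\<close> almost attains its infimum are therefore close.
\<close>

lemma quadratic_functional_attains_min:
  fixes h :: "'a::chilbert_space \<Rightarrow> real"
  assumes h: "bounded_linear h"
  shows "\<exists>y. \<forall>x. (norm y)\<^sup>2 - 2 * h y \<le> (norm x)\<^sup>2 - 2 * h x"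
proof -
  interpret h: bounded_linear h by (rule h)
  define J where "J = (\<lambda>x. (norm x)\<^sup>2 - 2 * h x)"
  define m where "m = Inf (range J)"
  obtain K where K: "\<And>x. norm (h x) \<le> norm x * K"
    using h.bounded by blast
  have "- K\<^sup>2 \<le> J x" for x
  proof -
    have "h x \<le> norm x * K"
      using K[of x] by simp
    moreover have "0 \<le> (norm x - K)\<^sup>2"
      by simp
    ultimately show ?thesis
      by (simp add: J_def power2_diff)
  qed
  then have bdd: "bdd_below (range J)"
    by (auto simp: bdd_below_def)
  have m_le: "m \<le> J x" for x
    unfolding m_def using bdd by (auto intro: cInf_lower)
  have "\<exists>x. J x < m + 1 / real (Suc n)" for n
    using cInf_lessD[of "range J" "m + 1 / real (Suc n)"] by (auto simp: m_def)
  then obtain X where X: "\<And>n. J (X n) < m + 1 / real (Suc n)"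
    by metis
  have close: "(norm (x - y))\<^sup>2 \<le> 2 * (J x - m) + 2 * (J y - m)" for x y
  proof -
    have "4 * J ((1/2) *\<^sub>R (x + y)) = (norm (x + y))\<^sup>2 - 4 * (h x + h y)"
      by (simp add: J_def h.scaleR h.add power2_eq_square add_divide_distrib)
    then show ?thesis
      using parallelogram_law[of x y] m_le[of "(1/2) *\<^sub>R (x + y)"] by (simp add: J_def)
  qed
  have "Cauchy X"
  proof (rule metric_CauchyI)
    fix e :: real
    assume e: "0 < e"
    then obtain N where N: "inverse (real (Suc N)) < e\<^sup>2 / 4"
      using reals_Archimedean[of "e\<^sup>2 / 4"] by auto
    have tail: "J (X n) - m < e\<^sup>2 / 4" if "n \<ge> N" for n
    proof -
      have "1 / real (Suc n) \<le> inverse (real (Suc N))"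
        using that by (simp add: field_simps)
      then show ?thesis
        using X[of n] N by linarith
    qed
    have "dist (X i) (X j) < e" if "i \<ge> N" "j \<ge> N" for i j
    proof -
      have "(norm (X i - X j))\<^sup>2 < e\<^sup>2"
        using close[of "X i" "X j"] tail[OF that(1)] tail[OF that(2)] by argo
      then show ?thesis
        using e by (simp add: dist_norm power_less_imp_less_base)
    qed
    then show "\<exists>N. \<forall>i\<ge>N. \<forall>j\<ge>N. dist (X i) (X j) < e"
      by blast
  qed
  then obtain y where y: "X \<longlonglongrightarrow> y"
    using Cauchy_convergent convergent_def by blast
  have "(\<lambda>n. J (X n)) \<longlonglongrightarrow> J y"
    unfolding J_def by (intro tendsto_intros h.tendsto y)
  moreover have "(\<lambda>n. m + 1 / real (Suc n)) \<longlonglongrightarrow> m + 0"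
    using LIMSEQ_inverse_real_of_nat
    by (intro tendsto_intros) (simp add: inverse_eq_divide)
  ultimately have "J y \<le> m + 0"
    using X by (blast intro: LIMSEQ_le less_imp_le)
  then show ?thesis
    using m_le unfolding J_def by (metis add_0_right order_trans)
qed

lemma riesz_representation_Re:
  fixes h :: "'a::chilbert_space \<Rightarrow> real"
  assumes h: "bounded_linear h"
  shows "\<exists>y. \<forall>x. h x = Re (cinner x y)"
proof -
  interpret h: bounded_linear h by (rule h)
  obtain y where y: "\<And>x. (norm y)\<^sup>2 - 2 * h y \<le> (norm x)\<^sup>2 - 2 * h x"
    using quadratic_functional_attains_min[OF h] by blast
  have "h z = Re (cinner z y)" for z
  proof -
    define d where "d = Re (cinner z y) - h z"
    \<comment> \<open>For \<open>z \<noteq> 0\<close> the optimal step along \<open>z\<close> is \<open>- d / \<parallel>z\<parallel>\<^sup>2\<close>; adding 1 to the denominator also covers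
        \<open>z = 0\<close> and still turns the variation below into \<open>t d - t\<^sup>2\<close>.\<close>
    define t where "t = - d / ((norm z)\<^sup>2 + 1)"
    have pos: "(norm z)\<^sup>2 + 1 > 0"
      by (simp add: add_nonneg_pos)
    have variation: "0 \<le> 2 * t * d + t\<^sup>2 * (norm z)\<^sup>2"
      using y[of "y + t *\<^sub>R z"]
      by (simp add: norm_add_scaleR_squared h.add h.scaleR d_def algebra_simps)
    have "t * ((norm z)\<^sup>2 + 1) = - d"
      using pos by (simp add: t_def)
    moreover have "t\<^sup>2 * (norm z)\<^sup>2 = t * (t * ((norm z)\<^sup>2 + 1)) - t\<^sup>2"
      by (simp add: power2_eq_square algebra_simps)
    ultimately have "t\<^sup>2 \<le> t * d"
      using variation by (simp add: mult.commute[of d])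
    moreover have "t * d \<le> 0"
      using pos by (simp add: t_def divide_nonpos_pos)
    ultimately have "t = 0"
      by (smt (verit) zero_less_power2)
    then have "d = 0"
      using pos by (simp add: t_def)
    then show ?thesis
      by (simp add: d_def)
  qed
  then show ?thesis
    by blast
qed

section \<open>Adjoints\<close>

text \<open>
  For fixed \<open>f\<close>, the vector \<open>T' f\<close> represents the functional \<open>x \<mapsto> Re \<langle>T x, f\<rangle>\<close>. Imaginary parts agree
  as well, because \<open>Im \<langle>x, y\<rangle> = Re \<langle>- \<i> x, y\<rangle>\<close> and \<open>T\<close> commutes with multiplication by \<open>- \<i>\<close>.
\<close>

lemma adjoint_exists:
  fixes T :: "'a::chilbert_space \<Rightarrow> 'b::complex_inner"
  assumes T: "bounded_clinear T"
  shows "\<exists>T'. \<forall>x f. cinner (T x) f = cinner x (T' f)"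
proof -
  interpret T: bounded_linear T
    using T by (simp add: bounded_clinear_def)
  have T_scaleC: "T (c *\<^sub>C x) = c *\<^sub>C T x" for c x
    using T by (simp add: bounded_clinear_def)
  have "\<exists>y. \<forall>x. cinner (T x) f = cinner x y" for f
  proof -
    obtain K where K: "\<And>x. norm (T x) \<le> norm x * K"
      using T.bounded by blast
    have "bounded_linear (\<lambda>x. Re (cinner (T x) f))"
    proof (rule bounded_linear_intro[where K = "K * norm f"])
      fix x
      have "norm (Re (cinner (T x) f)) \<le> norm (T x) * norm f"
        using abs_Re_cinner_le_norm by simp
      also have "\<dots> \<le> norm x * K * norm f"
        by (intro mult_right_mono K) simp
      finally show "norm (Re (cinner (T x) f)) \<le> norm x * (K * norm f)"
        by (simp add: mult.assoc)
    qed (simp_all add: T.add T.scaleR cinner_add_left cinner_scaleR_left)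
    then obtain y where y: "\<And>x. Re (cinner (T x) f) = Re (cinner x y)"
      using riesz_representation_Re by blast
    have "cinner (T x) f = cinner x y" for x
      by (rule complex_eqI) (simp_all only: y Im_cinner_conv_Re flip: T_scaleC)
    then show ?thesis
      by blast
  qed
  then show ?thesis
    by metis
qed

lemma adjoint_bounded:
  fixes T :: "'a::complex_inner \<Rightarrow> 'b::complex_inner"
  assumes T: "bounded_linear T" and adj: "\<And>x f. cinner (T x) f = cinner x (T' f)"
  shows "\<exists>K>0. \<forall>f. norm (T' f) \<le> K * norm f"
proof -
  obtain K where K: "K > 0" "\<And>x. norm (T x) \<le> norm x * K"
    using bounded_linear.pos_bounded[OF T] by blast
  have "norm (T' f) \<le> K * norm f" for f
  proof (cases "T' f = 0")
    case False
    have "(norm (T' f))\<^sup>2 = Re (cinner (T (T' f)) f)"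
      by (simp add: adj Re_cinner_self)
    also have "\<dots> \<le> norm (T (T' f)) * norm f"
      by (rule Re_cinner_le_norm)
    also have "\<dots> \<le> norm (T' f) * K * norm f"
      by (intro mult_right_mono K) simp
    finally show ?thesis
      using False by (simp add: power2_eq_square mult.assoc)
  qed (use K in simp)
  then show ?thesis
    using K by blast
qed

text \<open>
  With \<open>S\<close> the right inverse, \<open>\<parallel>f\<parallel>\<^sup>2 = \<langle>T (S f), f\<rangle> = \<langle>S f, T' f\<rangle>\<close>, and Cauchy-Schwarz gives a
  factor \<open>\<parallel>T' f\<parallel>\<close> on the right.
\<close>

lemma adjoint_bounded_below:
  fixes T :: "'a::complex_inner \<Rightarrow> 'b::complex_inner"
  assumes S: "bounded_linear S" and TS: "\<And>f. T (S f) = f"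
    and adj: "\<And>x f. cinner (T x) f = cinner x (T' f)"
  shows "\<exists>K>0. \<forall>f. norm f \<le> K * norm (T' f)"
proof -
  obtain K where K: "K > 0" "\<And>x. norm (S x) \<le> norm x * K"
    using bounded_linear.pos_bounded[OF S] by blast
  have "norm f \<le> K * norm (T' f)" for f
  proof (cases "f = 0")
    case False
    have "(norm f)\<^sup>2 = Re (cinner (S f) (T' f))"
      by (simp add: TS Re_cinner_self flip: adj)
    also have "\<dots> \<le> norm (S f) * norm (T' f)"
      by (rule Re_cinner_le_norm)
    also have "\<dots> \<le> norm f * K * norm (T' f)"
      by (intro mult_right_mono K) simp
    finally show ?thesis
      using False by (simp add: power2_eq_square mult.assoc)
  qed (use K in simp)
  then show ?thesis
    using K by blast
qed

section \<open>Images of biframes\<close>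

text \<open>
  The right inverse supplies the lower frame bound: that bound asks that \<open>T'\<close> be bounded below,
  which amounts to surjectivity of \<open>T\<close>.
\<close>

lemma continuous_biframe_image:
  fixes T :: "'a::chilbert_space \<Rightarrow> 'b::complex_inner"
  assumes T: "bounded_clinear T" and S: "bounded_linear S" and TS: "\<And>f. T (S f) = f"
    and FG: "continuous_biframe M F G"
  shows "continuous_biframe M (T \<circ> F) (T \<circ> G)"
proof -
  obtain T' where adj: "\<And>x f. cinner (T x) f = cinner x (T' f)"
    using adjoint_exists[OF T] by blast
  have adj': "cinner f (T x) = cinner (T' f) x" for f x
    by (metis adj cinner_commute)
  obtain K where K: "K > 0" "\<And>f. norm (T' f) \<le> K * norm f"
    using adjoint_bounded[OF _ adj] T by (auto simp: bounded_clinear_def)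
  obtain L where L: "L > 0" "\<And>f. norm f \<le> L * norm (T' f)"
    using adjoint_bounded_below[OF S TS adj] by blast
  define Q where "Q = (\<lambda>f. \<integral>w. cinner f (F w) * cinner (G w) f \<partial>M)"
  obtain A B where A: "0 < A" and AB: "A \<le> B"
    and int: "\<And>f. integrable M (\<lambda>w. cinner f (F w) * cinner (G w) f)"
    and real: "\<And>f. Q f \<in> \<real>"
    and lower: "\<And>f. A * (norm f)\<^sup>2 \<le> Re (Q f)"
    and upper: "\<And>f. Re (Q f) \<le> B * (norm f)\<^sup>2"
    using FG unfolding continuous_biframe_def Q_def by blast
  have meas: "weakly_measurable M (T \<circ> F)" "weakly_measurable M (T \<circ> G)"
    using FG by (simp_all add: continuous_biframe_def weakly_measurable_def adj')
  \<comment> \<open>In the zero space no vector compares the two constants, so the upper one is a maximum.\<close>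
  define A' B' where "A' = A / L\<^sup>2" and "B' = max A' (B * K\<^sup>2)"
  have "0 < A'" "A' \<le> B'"
    using A L by (simp_all add: A'_def B'_def)
  moreover have "A' * (norm f)\<^sup>2 \<le> Re (Q (T' f))" for f
  proof -
    have "(norm f)\<^sup>2 \<le> L\<^sup>2 * (norm (T' f))\<^sup>2"
      using power_mono[OF L(2), of f 2] by (simp add: power_mult_distrib)
    then have "A' * (norm f)\<^sup>2 \<le> A' * (L\<^sup>2 * (norm (T' f))\<^sup>2)"
      using \<open>0 < A'\<close> by (intro mult_left_mono) auto
    also have "\<dots> = A * (norm (T' f))\<^sup>2"
      using L by (simp add: A'_def)
    finally show ?thesis
      using lower[of "T' f"] by linarith
  qed
  moreover have "Re (Q (T' f)) \<le> B' * (norm f)\<^sup>2" for f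
  proof -
    have "(norm (T' f))\<^sup>2 \<le> K\<^sup>2 * (norm f)\<^sup>2"
      using power_mono[OF K(2), of f 2] by (simp add: power_mult_distrib)
    then have "B * (norm (T' f))\<^sup>2 \<le> B * (K\<^sup>2 * (norm f)\<^sup>2)"
      using A AB by (intro mult_left_mono) auto
    also have "\<dots> \<le> B' * (norm f)\<^sup>2"
      unfolding mult.assoc[symmetric] by (intro mult_right_mono) (simp_all add: B'_def)
    finally show ?thesis
      using upper[of "T' f"] by linarith
  qed
  ultimately have "\<exists>A B. 0 < A \<and> A \<le> B \<and>
      (\<forall>f. integrable M (\<lambda>w. cinner (T' f) (F w) * cinner (G w) (T' f)) \<and>
        Q (T' f) \<in> \<real> \<and> A * (norm f)\<^sup>2 \<le> Re (Q (T' f)) \<and> Re (Q (T' f)) \<le> B * (norm f)\<^sup>2)"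
    using int real by blast
  with meas show ?thesis
    by (simp add: continuous_biframe_def comp_def adj adj' Q_def)
qed

theorem theorem3p10:
  fixes M :: "'w measure"
    and F G :: "'w \<Rightarrow> 'h::chilbert_space"
    and T :: "'h \<Rightarrow> 'h"
  assumes "invertible_bounded_clinear T"
  shows "continuous_biframe M F G \<longleftrightarrow> continuous_biframe M (T \<circ> F) (T \<circ> G)"
proof -
  obtain S where T: "bounded_clinear T" and S: "bounded_clinear S"
    and ST: "S \<circ> T = id" and TS: "T \<circ> S = id"
    using assms unfolding invertible_bounded_clinear_def by blast
  have TS': "T (S f) = f" and ST': "S (T f) = f" for f
    using TS ST by (simp_all add: fun_eq_iff)
  have lin: "bounded_linear T" "bounded_linear S"
    using T S by (simp_all add: bounded_clinear_def)
  show ?thesis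
  proof
    assume "continuous_biframe M F G"
    then show "continuous_biframe M (T \<circ> F) (T \<circ> G)"
      by (rule continuous_biframe_image[OF T lin(2) TS'])
  next
    assume "continuous_biframe M (T \<circ> F) (T \<circ> G)"
    then have "continuous_biframe M (S \<circ> (T \<circ> F)) (S \<circ> (T \<circ> G))"
      by (rule continuous_biframe_image[OF S lin(1) ST'])
    then show "continuous_biframe M F G"
      by (simp add: comp_assoc[symmetric] ST)
  qed
qed

end
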